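(* Let $0\leqslant k\leqslant 1$ and $m\geqslant 1$ be real numbers, and let $F\in\mathcal S_H^0(k,m)$. Then $$|F(z)|\geqslant \frac{|z|}{4\,(1+k|z|^m)^{2/m}}\qquad\text{for all } z\in\mathbb D.$$ In particular, for any function $F\in\mathcal S_H^0(k,m)$ the set $F(\mathbb D)$ contains the disk $\bigl\{w\in\mathbb C : |w|<1/\bigl(4(1+k)^{2/m}\bigr)\bigr\}$.
   Context: $\mathbb D=\{z\in\mathbb C:|z|<1\}$. Every complex-valued harmonic function $f$ in $\mathbb D$ has the form $f=h+\overline{g}$ with $h,g$ holomorphic in $\mathbb D$. The class $\mathcal S_H^0$ consists of all complex-valued harmonic functions $f=h+\overline g$ in $\mathbb D$ that are univalent (injective) in $\mathbb D$ and satisfy $h(0)=g(0)=g'(0)=0$ and $h'(0)=1$. The analytic dilatation of $f=h+\overline g\in\mathcal S_H^0$ is $w_f(z)=g'(z)/h'(z)$. For numbers $0\leqslant k\leqslant 1$ and $m\geqslant1$, define $$\mathcal S_H^0(k,m)=\{f\in\mathcal S_H^0 : |w_f(z)|\leqslant k|z|^m \text{ for all } z\in\mathbb D\}.$$ *)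

theory Defs
  imports "HOL-Complex_Analysis.Complex_Analysis"
begin

definition dir_deriv :: "complex \<Rightarrow> (complex \<Rightarrow> complex) \<Rightarrow> complex \<Rightarrow> complex" where
  "dir_deriv v f z = vector_derivative (\<lambda>t::real. f (z + of_real t * v)) (at 0)"

text \<open>The directions \<open>1\<close> and \<open>\<i>\<close> give the partial derivatives with respect to the real and the
  imaginary part.\<close>

definition C1_on :: "(complex \<Rightarrow> complex) \<Rightarrow> complex set \<Rightarrow> bool" where
  "C1_on f S \<longleftrightarrow>
     (\<forall>v\<in>{1, \<i>}. (\<forall>z\<in>S. (\<lambda>t::real. f (z + of_real t * v)) differentiable (at 0)) \<and>
                 continuous_on S (dir_deriv v f))"

definition C2_on :: "(complex \<Rightarrow> complex) \<Rightarrow> complex set \<Rightarrow> bool" where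
  "C2_on f S \<longleftrightarrow> C1_on f S \<and> (\<forall>v\<in>{1, \<i>}. C1_on (dir_deriv v f) S)"

definition harmonic_on :: "(complex \<Rightarrow> complex) \<Rightarrow> complex set \<Rightarrow> bool" where
  "harmonic_on f S \<longleftrightarrow> open S \<and> C2_on f S \<and>
     (\<forall>z\<in>S. dir_deriv 1 (dir_deriv 1 f) z + dir_deriv \<i> (dir_deriv \<i> f) z = 0)"

abbreviation unit_disk :: "complex set" (\<open>\<D>\<close>) where
  "\<D> \<equiv> ball 0 1"

definition harmonic_decomp :: "(complex \<Rightarrow> complex) \<Rightarrow> (complex \<Rightarrow> complex) \<Rightarrow> (complex \<Rightarrow> complex) \<Rightarrow> bool" where
  "harmonic_decomp f h g \<longleftrightarrow> h holomorphic_on \<D> \<and> g holomorphic_on \<D> \<and>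
     (\<forall>z\<in>\<D>. f z = h z + cnj (g z)) \<and> h 0 = 0 \<and> g 0 = 0"

definition S_H0 :: "(complex \<Rightarrow> complex) set" where
  "S_H0 = {f. harmonic_on f \<D> \<and> inj_on f \<D> \<and>
              (\<exists>h g. harmonic_decomp f h g \<and> deriv g 0 = 0 \<and> deriv h 0 = 1)}"

definition dilatation :: "(complex \<Rightarrow> complex) \<Rightarrow> (complex \<Rightarrow> complex) \<Rightarrow> complex \<Rightarrow> complex" where
  "dilatation h g z = deriv g z / deriv h z"

text \<open>The pair \<open>h\<close>, \<open>g\<close> is determined on the disk by \<open>f\<close> (lemma \<open>harmonic_decomp_unique\<close> below), so
  the existential quantifier merely names the two parts of \<open>f\<close>. For a univalent \<open>f\<close> with
  \<open>\<bar>g' 0\<bar> < \<bar>h' 0\<bar>\<close> the derivative of \<open>h\<close> has no zero in the disk (Lewy's theorem), so the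
  convention \<open>x / 0 = 0\<close> plays no role in the dilatation.\<close>

definition S_H0_km :: "real \<Rightarrow> real \<Rightarrow> (complex \<Rightarrow> complex) set" where
  "S_H0_km k m = {f \<in> S_H0. \<exists>h g. harmonic_decomp f h g \<and>
                     (\<forall>z\<in>\<D>. norm (dilatation h g z) \<le> k * norm z powr m)}"

lemma C1_on_holomorphic_plus_cnj:
  assumes "open S" and h: "h holomorphic_on S" and g: "g holomorphic_on S"
    and f: "\<And>z. z \<in> S \<Longrightarrow> f z = h z + cnj (g z)"
  shows "C1_on f S"
    and "z \<in> S \<Longrightarrow> dir_deriv v f z = v * deriv h z + cnj (v * deriv g z)"
proof -
  have vd: "((\<lambda>t::real. f (z + of_real t * v)) has_vector_derivative
               v * deriv h z + cnj (v * deriv g z)) (at 0)" if z: "z \<in> S" for z v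
  proof -
    have line: "((\<lambda>t::real. z + of_real t * v) has_vector_derivative v) (at 0)"
      by (auto intro!: derivative_eq_intros)
    have chain: "((\<lambda>t::real. p (z + of_real t * v)) has_vector_derivative v * deriv p z) (at 0)"
      if "p holomorphic_on S" for p
    proof -
      have "(p has_field_derivative deriv p z) (at (z + of_real 0 * v))"
        using holomorphic_derivI[OF that \<open>open S\<close> z] by simp
      from field_vector_diff_chain_at[OF line this] show ?thesis
        by (simp add: o_def)
    qed
    have sum: "((\<lambda>t::real. h (z + of_real t * v) + cnj (g (z + of_real t * v))) has_vector_derivative
                 v * deriv h z + cnj (v * deriv g z)) (at 0)"
      by (intro has_vector_derivative_add has_vector_derivative_cnj chain h g)
    have "isCont (\<lambda>t::real. z + of_real t * v) 0"
      by (intro continuous_intros)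
    then have "\<forall>\<^sub>F t in at (0::real). z + of_real t * v \<in> S"
      using \<open>open S\<close> z by (intro topological_tendstoD[where f = "\<lambda>t. z + of_real t * v" and l = z])
        (auto simp: isCont_def)
    then have "\<forall>\<^sub>F t in at (0::real). h (z + of_real t * v) + cnj (g (z + of_real t * v)) = f (z + of_real t * v)"
      by eventually_elim (simp add: f)
    with sum show ?thesis
      unfolding has_vector_derivative_def
      by (rule has_derivative_transform_eventually) (use z in \<open>simp_all add: f\<close>)
  qed
  show eq: "dir_deriv v f z = v * deriv h z + cnj (v * deriv g z)" if "z \<in> S" for v z
    unfolding dir_deriv_def using vd[OF that] by (rule vector_derivative_at)
  have "continuous_on S (dir_deriv v f)" for v
  proof -
    have "continuous_on S (\<lambda>z. v * deriv h z + cnj (v * deriv g z))"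
      using holomorphic_deriv[OF h \<open>open S\<close>] holomorphic_deriv[OF g \<open>open S\<close>]
      by (intro continuous_intros holomorphic_on_imp_continuous_on)
    then show ?thesis
      using eq by (simp cong: continuous_on_cong)
  qed
  moreover have "(\<lambda>t::real. f (z + of_real t * v)) differentiable (at 0)" if "z \<in> S" for z v
    using vd[OF that] by (auto intro: differentiableI_vector)
  ultimately show "C1_on f S"
    by (auto simp: C1_on_def)
qed

lemma harmonic_on_holomorphic_plus_cnj:
  assumes "open S" and h: "h holomorphic_on S" and g: "g holomorphic_on S"
    and f: "\<And>z. z \<in> S \<Longrightarrow> f z = h z + cnj (g z)"
  shows "harmonic_on f S"
proof -
  note first = C1_on_holomorphic_plus_cnj[OF assms]
  have hv: "(\<lambda>z. v * deriv h z) holomorphic_on S" and gv: "(\<lambda>z. v * deriv g z) holomorphic_on S" for v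
    using holomorphic_deriv[OF h \<open>open S\<close>] holomorphic_deriv[OF g \<open>open S\<close>]
    by (auto intro!: holomorphic_intros)
  note second = C1_on_holomorphic_plus_cnj[OF \<open>open S\<close> hv gv first(2)]
  have d: "deriv (\<lambda>z. v * deriv p z) z = v * deriv (deriv p) z"
    if "p holomorphic_on S" "z \<in> S" for v p z
    using holomorphic_deriv[OF that(1) \<open>open S\<close>] that(2) \<open>open S\<close>
    by (intro deriv_cmult) (auto simp: holomorphic_on_open field_differentiable_def)
  have "dir_deriv 1 (dir_deriv 1 f) z + dir_deriv \<i> (dir_deriv \<i> f) z = 0" if "z \<in> S" for z
    using that by (simp add: second(2) d h g algebra_simps flip: mult.assoc)
  then show ?thesis
    using \<open>open S\<close> first(1) second(1) by (auto simp: harmonic_on_def C2_on_def)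
qed

lemma harmonic_decomp_unique:
  assumes "harmonic_decomp f h1 g1" "harmonic_decomp f h2 g2" "z \<in> \<D>"
  shows "h1 z = h2 z" "g1 z = g2 z"
proof -
  have hol: "h1 holomorphic_on \<D>" "g1 holomorphic_on \<D>" "h2 holomorphic_on \<D>" "g2 holomorphic_on \<D>"
    and f: "\<And>z. z \<in> \<D> \<Longrightarrow> f z = h1 z + cnj (g1 z)" "\<And>z. z \<in> \<D> \<Longrightarrow> f z = h2 z + cnj (g2 z)"
    and zero: "h1 0 = 0" "h2 0 = 0"
    using assms by (auto simp: harmonic_decomp_def)
  have "deriv h1 w = deriv h2 w" if w: "w \<in> \<D>" for w
  proof -
    have "v * deriv h1 w + cnj (v * deriv g1 w) = v * deriv h2 w + cnj (v * deriv g2 w)" for v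
      using C1_on_holomorphic_plus_cnj(2)[OF _ hol(1,2) f(1) w, of v]
        C1_on_holomorphic_plus_cnj(2)[OF _ hol(3,4) f(2) w, of v] by simp
    from this[of 1] this[of \<i>] show ?thesis
      by (simp add: complex_eq_iff)
  qed
  then have "((\<lambda>z. h1 z - h2 z) has_field_derivative 0) (at w within \<D>)" if "w \<in> \<D>" for w
    using holomorphic_derivI[OF hol(1) _ that] holomorphic_derivI[OF hol(3) _ that] that
    by (auto intro!: derivative_eq_intros)
  then obtain c where c: "\<And>w. w \<in> \<D> \<Longrightarrow> h1 w - h2 w = c"
    using has_field_derivative_zero_constant[of \<D> "\<lambda>z. h1 z - h2 z"] by auto
  from c[of 0] zero c[OF assms(3)] show h: "h1 z = h2 z"
    by simp
  with f[OF assms(3)] show "g1 z = g2 z"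
    by simp
qed

end

theory Submission
  imports Defs
begin

text \<open>Let \<open>F\<close> omit the value \<open>w\<close> on the disk of radius \<open>r\<close>. Writing \<open>F = 4 w q / (1 + q)\<^sup>2\<close> gives an injective
  function \<open>q\<close> with \<open>q z \<sim> z / (4 w)\<close> at 0, and injectivity of \<open>F\<close> also forces \<open>q z * q z' \<noteq> 1\<close>.
  Hence \<open>V \<zeta> = ln (q (exp \<zeta>))\<close> and \<open>-V\<close> map the strip \<open>ln \<epsilon> < Re \<zeta> < ln \<beta>\<close>, modulo \<open>2\<pi>\<i>\<close>, injectively onto
  disjoint subsets of \<open>\<bar>Re\<bar> \<le> M\<close> with \<open>M = ln (4 \<bar>w\<bar> / \<epsilon>) + o(1)\<close>, so the area of the image of \<open>V\<close> is at most
  \<open>2\<pi> M\<close>. Every vertical segment of length \<open>2\<pi>\<close> has an image of length at least \<open>2\<pi>\<close>, and the dilatation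
  of \<open>V\<close> is at most \<open>\<kappa> = k exp (m Re \<zeta>)\<close>; the length-area principle bounds the area below by \<open>2\<pi>\<close> times the
  integral of \<open>(1 - \<kappa>) / (1 + \<kappa>)\<close>, which is \<open>ln \<beta> - ln \<epsilon> - (2 / m) ln (1 + k \<beta> powr m)\<close> up to a
  nonnegative term. Let \<open>\<epsilon> \<rightarrow> 0\<close> and \<open>\<beta> \<rightarrow> r\<close>. Both claims follow: \<open>F\<close> omits \<open>F z\<close> on the disk of radius \<open>\<bar>z\<bar>\<close>, and a
  value outside \<open>F ` \<D>\<close> is omitted for \<open>r = 1\<close>.\<close>

no_notation fps_nth (infixl "$" 75)

section \<open>Logarithms, disks and areas in the plane\<close>

text \<open>Near \<open>a\<close>, continuity keeps the imaginary part of \<open>L z - L a\<close>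
  in the range where \<open>Ln\<close> inverts \<open>exp\<close>, so a continuous logarithm is
  locally a translate of the principal branch.\<close>

lemma eventually_eq_continuous_log:
  fixes L u :: "complex \<Rightarrow> complex"
  assumes S: "open S" "a \<in> S" and L: "continuous_on S L"
    and eq: "\<And>z. z \<in> S \<Longrightarrow> exp (L z) = u z"
  shows "\<forall>\<^sub>F z in nhds a. L z = L a + Ln (u z / u a)"
proof -
  have "isCont L a"
    using S L continuous_on_eq_continuous_at by blast
  then have "((\<lambda>z. L z - L a) \<longlongrightarrow> L a - L a) (nhds a)"
    by (intro tendsto_intros) (simp add: isCont_def tendsto_at_iff_tendsto_nhds)
  then have "\<forall>\<^sub>F z in nhds a. L z - L a \<in> ball 0 pi"
    by (intro topological_tendstoD) auto
  moreover have "\<forall>\<^sub>F z in nhds a. z \<in> S"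
    using S eventually_nhds_in_open by blast
  ultimately show ?thesis
  proof eventually_elim
    case (elim z)
    then have "\<bar>Im (L z - L a)\<bar> < pi"
      using abs_Im_le_cmod[of "L z - L a"] by simp
    then have "Ln (exp (L z - L a)) = L z - L a"
      by (intro Ln_exp) auto
    with elim S eq show ?case
      by (simp add: exp_diff)
  qed
qed

text \<open>Derivatives are only real-linear here because the harmonic function need not be
  holomorphic. Dividing by \<open>u a\<close> moves the argument of \<open>Ln\<close> to 1, away
  from the branch cut.\<close>

lemma has_derivative_continuous_log:
  fixes L u :: "complex \<Rightarrow> complex"
  assumes S: "open S" "a \<in> S" and L: "continuous_on S L"
    and eq: "\<And>z. z \<in> S \<Longrightarrow> exp (L z) = u z"
    and u: "(u has_derivative u') (at a)"
  shows "(L has_derivative (\<lambda>v. u' v / u a)) (at a)"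
proof -
  have [simp]: "u a \<noteq> 0"
    using eq[OF S(2)] by (metis exp_not_eq_zero)
  have q: "((\<lambda>z. u z / u a) has_derivative (\<lambda>v. u' v / u a)) (at a)"
    using bounded_linear.has_derivative[OF bounded_linear_divide u] .
  have "(Ln has_field_derivative inverse (u a / u a)) (at (u a / u a))"
    by (intro has_field_derivative_Ln) simp
  then have "(Ln has_derivative (*) 1) (at (u a / u a))"
    by (simp add: has_field_derivative_def)
  from has_derivative_compose[OF q this]
  have "((\<lambda>z. L a + Ln (u z / u a)) has_derivative (\<lambda>v. 0 + 1 * (u' v / u a))) (at a)"
    by (intro derivative_intros)
  then have "((\<lambda>z. L a + Ln (u z / u a)) has_derivative (\<lambda>v. u' v / u a)) (at a)"
    by simp
  then show ?thesis
  proof (rule has_derivative_transform_eventually)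
    show "\<forall>\<^sub>F z in at a. L a + Ln (u z / u a) = L z"
      using eventually_eq_continuous_log[OF S L eq]
      by (auto simp: eventually_at_filter elim!: eventually_mono)
  qed auto
qed

text \<open>Invariance of domain makes the image of the open ball open, and compactness makes that
  of the closed ball closed. Both have the same trace on \<open>ball (f a) \<delta>\<close>, since
  the sphere is mapped outside it; this trace is clopen and contains \<open>f a\<close>, so
  connectedness finishes.\<close>

lemma ball_subset_inj_image:
  fixes f :: "'a::euclidean_space \<Rightarrow> 'a"
  assumes f: "continuous_on (cball a e) f" "inj_on f (cball a e)" and "0 < e"
    and far: "\<And>z. z \<in> sphere a e \<Longrightarrow> \<delta> \<le> dist (f a) (f z)"
  shows "ball (f a) \<delta> \<subseteq> f ` ball a e"
proof (cases "\<delta> > 0")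
  case True
  have eq: "ball (f a) \<delta> \<inter> f ` cball a e = ball (f a) \<delta> \<inter> f ` ball a e"
  proof -
    have "f z \<in> f ` ball a e" if "z \<in> cball a e" "f z \<in> ball (f a) \<delta>" for z
      using that far[of z] by (cases "dist a z = e") auto
    then show ?thesis
      by (auto simp: image_iff)
  qed
  have "open (f ` ball a e)"
    using invariance_of_domain_ball f \<open>0 < e\<close> by blast
  moreover have "closed (f ` cball a e)"
    by (intro compact_imp_closed compact_continuous_image f) auto
  moreover have "connected (ball (f a) \<delta>)"
    by (simp add: convex_connected)
  moreover have "f a \<in> ball (f a) \<delta> \<inter> f ` ball a e"
    using True \<open>0 < e\<close> by auto
  ultimately have "ball (f a) \<delta> \<inter> f ` ball a e = ball (f a) \<delta>"
    using connected_clopen[of "ball (f a) \<delta>"] eq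
    by (metis closedin_closed_Int empty_iff openin_open_Int)
  then show ?thesis
    by blast
qed (simp add: ball_empty)

text \<open>A bridge between iterated integrals, taken over \<open>real \<times> real\<close>, and
  the change of variables for areas, used on \<open>real^2\<close>. The coordinate identification
  preserves boxes and their content.\<close>

lemma has_integral_vec2:
  fixes f :: "complex \<Rightarrow> real"
  assumes f: "continuous_on {z. a \<le> Re z \<and> Re z \<le> b \<and> c \<le> Im z \<and> Im z \<le> d} f"
  shows "((\<lambda>x::real^2. f (Complex (x$1) (x$2))) has_integral
           integral {a..b} (\<lambda>s. integral {c..d} (\<lambda>t. f (Complex s t))))
         (cbox (vector [a, c]) (vector [b, d]))"
proof -
  define h where "h = (\<lambda>p::real \<times> real. vector [fst p, snd p] :: real^2)"
  define g where "g = (\<lambda>x::real^2. (x$1, x$2))"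
  define fp where "fp = (\<lambda>p. f (Complex (fst p) (snd p)))"
  have cont: "continuous_on (cbox (a, c) (b, d)) fp"
    unfolding fp_def
    by (rule continuous_on_compose2[OF f])
       (auto simp: Complex_eq cbox_Pair_iff intro!: continuous_intros)
  then have "(fp has_integral integral {a..b} (\<lambda>s. integral {c..d} (\<lambda>t. f (Complex s t))))
      (cbox (a, c) (b, d))"
    using integral_prod_continuous[OF cont] integrable_continuous[OF cont]
    by (simp add: has_integral_iff fp_def)
  moreover have him: "h ` cbox (u1, u2) (v1, v2) = cbox (vector [u1, u2]) (vector [v1, v2])"
    for u1 u2 v1 v2
  proof -
    have "x = h (x$1, x$2)" for x :: "real^2"
      by (simp add: h_def vec_eq_iff forall_2)
    then show ?thesis
      by (force simp: h_def mem_box_cart forall_2 image_iff cbox_Pair_iff)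
  qed
  moreover have gim: "g ` cbox u v = cbox (u$1, u$2) (v$1, v$2)" for u v
  proof -
    have "p = g (vector [fst p, snd p])" for p :: "real \<times> real"
      by (simp add: g_def)
    then show ?thesis
      by (fastforce simp: g_def mem_box_cart forall_2 cbox_Pair_eq intro!: image_eqI)
  qed
  \<comment> \<open>The factor \<open>1/1\<close> is the inverse content ratio in the form that
    \<open>has_integral_twiddle\<close> expects.\<close>
  ultimately have "((\<lambda>x. fp (g x)) has_integral (1/1) *\<^sub>R
      integral {a..b} (\<lambda>s. integral {c..d} (\<lambda>t. f (Complex s t)))) (h ` cbox (a, c) (b, d))"
  proof (intro has_integral_twiddle)
    show "h (g x) = x" for x
      by (simp add: h_def g_def vec_eq_iff forall_2)
    show "g (h x) = x" for x
      by (simp add: h_def g_def)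
    show "isCont g x" for x
      unfolding g_def by (intro continuous_intros)
    show "\<exists>w z. h ` cbox u v = cbox w z" for u v
      by (metis him surj_pair)
    show "Henstock_Kurzweil_Integration.content (g ` cbox u v) =
        1 * Henstock_Kurzweil_Integration.content (cbox u v)" for u v
      by (cases "cbox u v = {}")
        (auto simp: gim content_Pair content_cbox_if_cart content_real_if UNIV_2 interval_eq_empty_cart
          mem_box_cart forall_2 set_eq_iff)
  qed auto
  then show ?thesis
    by (simp add: fp_def g_def him)
qed

text \<open>Cut \<open>S\<close> into slabs of height \<open>p\<close> and translate each into the
  rectangle \<open>Q\<close> of width \<open>2 * M\<close> and height \<open>p\<close>. As no two
  points of \<open>S\<close> differ by a nonzero multiple of the vertical period, the translates are
  disjoint.\<close>

lemma measure_le_of_inj_mod_period: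
  fixes S :: "(real^2) set"
  assumes S: "S \<in> lmeasurable" "bounded S" and p: "p > 0" and "0 \<le> M"
    and strip: "\<And>x. x \<in> S \<Longrightarrow> \<bar>x$1\<bar> \<le> M"
    and inj: "\<And>x y (n::int). x \<in> S \<Longrightarrow> y \<in> S \<Longrightarrow> x$1 = y$1 \<Longrightarrow> x$2 = y$2 + of_int n * p \<Longrightarrow> n = 0"
  shows "measure lebesgue S \<le> 2 * M * p"
proof -
  define T where "T n = S \<inter> {x. of_int n * p \<le> x$2 \<and> x$2 < (of_int n + 1) * p}" for n :: int
  define e where "e n = (vector [0, - of_int n * p] :: real^2)" for n :: int
  define Q where "Q = cbox (vector [-M, 0] :: real^2) (vector [M, p])"
  have floor: "x \<in> T n \<longleftrightarrow> x \<in> S \<and> \<lfloor>x$2 / p\<rfloor> = n" for x n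
    using p by (auto simp: T_def floor_eq_iff field_simps)
  obtain B where B: "\<And>x. x \<in> S \<Longrightarrow> norm x \<le> B"
    using S(2) by (auto simp: bounded_iff)
  \<comment> \<open>Boundedness of \<open>S\<close> leaves finitely many slabs, so finite additivity
    is enough.\<close>
  define I where "I = {- \<lceil>B / p\<rceil> - 1 .. \<lceil>B / p\<rceil> + 1}"
  have "\<lfloor>x$2 / p\<rfloor> \<in> I" if "x \<in> S" for x
  proof -
    have "\<bar>x$2\<bar> \<le> B"
      using B[OF that] component_le_norm_cart[of x 2] by linarith
    then have "x$2 / p \<le> B / p" "- (B / p) \<le> x$2 / p"
      using p by (auto simp: field_simps)
    then show ?thesis
      unfolding I_def by simp linarith
  qed
  then have SU: "S = (\<Union>n\<in>I. T n)"
    by (auto simp: floor)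
  have "closed {x::real^2. of_int n * p \<le> x$2}" "open {x::real^2. x$2 < (of_int n + 1) * p}" for n :: int
    by (auto intro!: closed_Collect_le open_Collect_less continuous_intros)
  then have "{x::real^2. of_int n * p \<le> x$2} \<inter> {x. x$2 < (of_int n + 1) * p} \<in> sets lebesgue" for n :: int
    by (intro sets.Int) (auto simp: borel_closed borel_open)
  then have TM: "T n \<in> lmeasurable" for n
    unfolding T_def Collect_conj_eq by (intro fmeasurable_Int_fmeasurable S) 
  have "measure lebesgue S = (\<Sum>n\<in>I. measure lebesgue (T n))"
    unfolding SU using TM
    by (intro measure_UNION') (auto simp: I_def pairwise_def disjnt_def floor)
  also have "\<dots> = (\<Sum>n\<in>I. measure lebesgue ((+) (e n) ` T n))"
    by (simp add: measure_translation)
  also have "\<dots> = measure lebesgue (\<Union>n\<in>I. (+) (e n) ` T n)"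
  proof (intro measure_UNION'[symmetric] pairwiseI)
    fix m n :: int assume "m \<noteq> n"
    have False if "x \<in> T m" "y \<in> T n" "e m + x = e n + y" for x y
    proof -
      have "(e m + x)$1 = (e n + y)$1" "(e m + x)$2 = (e n + y)$2"
        using that by auto
      then have "x$1 = y$1" "x$2 = y$2 + of_int (m - n) * p"
        by (auto simp: e_def algebra_simps)
      then show False
        using inj[of x y "m - n"] that \<open>m \<noteq> n\<close> by (auto simp: T_def)
    qed
    then show "disjnt ((+) (e m) ` T m) ((+) (e n) ` T n)"
      by (auto simp: disjnt_def)
  qed (auto simp: I_def measurable_translation TM)
  also have "\<dots> \<le> measure lebesgue Q"
  proof (rule measure_mono_fmeasurable)
    show "(\<Union>n\<in>I. (+) (e n) ` T n) \<subseteq> Q"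
      using strip
      by (fastforce simp: Q_def T_def e_def mem_box_cart forall_2 algebra_simps abs_le_iff)
    show "(\<Union>n\<in>I. (+) (e n) ` T n) \<in> sets lebesgue"
      by (auto simp: I_def measurable_translation TM fmeasurableD intro!: sets.finite_UN)
  qed (auto simp: Q_def)
  also have "\<dots> = 2 * M * p"
  proof -
    have "vector [M, p] \<in> Q"
      using p \<open>0 \<le> M\<close> by (simp add: Q_def mem_box_cart forall_2)
    then have "Q \<noteq> {}"
      by blast
    then show ?thesis
      unfolding Q_def by (simp add: content_cbox_cart UNIV_2)
  qed
  finally show ?thesis .
qed

text \<open>The real-linear map \<open>v \<mapsto> A * v + B * cnj v\<close> has determinant |A|^2 -
  |B|^2, which is therefore the Jacobian in the change of variables.\<close>

lemma has_integral_area_vec2: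
  fixes V A B :: "complex \<Rightarrow> complex" and S :: "(real^2) set"
  defines "f \<equiv> \<lambda>x::real^2. vector [Re (V (Complex (x$1) (x$2))), Im (V (Complex (x$1) (x$2)))] :: real^2"
  assumes S: "S \<in> sets lebesgue"
    and der: "\<And>x. x \<in> S \<Longrightarrow>
      (V has_derivative (\<lambda>v. A (Complex (x$1) (x$2)) * v + B (Complex (x$1) (x$2)) * cnj v))
      (at (Complex (x$1) (x$2)))"
    and inj: "inj_on f S"
    and int: "((\<lambda>x. \<bar>(norm (A (Complex (x$1) (x$2))))\<^sup>2 - (norm (B (Complex (x$1) (x$2))))\<^sup>2\<bar>) has_integral I) S"
  shows "f ` S \<in> lmeasurable" "measure lebesgue (f ` S) = I"
proof -
  define T where "T z = (vector [Re z, Im z] :: real^2)" for z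
  define U where "U x = Complex (x$1) (x$2)" for x :: "real^2"
  define f' where "f' x v = T (A (U x) * U v + B (U x) * cnj (U v))" for x v
  have T: "bounded_linear T"
    by (intro linear_conv_bounded_linear[THEN iffD1] linearI) (auto simp: T_def vec_eq_iff forall_2)
  have U: "bounded_linear U"
    by (intro linear_conv_bounded_linear[THEN iffD1] linearI) (auto simp: U_def complex_eq_iff)
  have "(f has_derivative f' x) (at x within S)" if "x \<in> S" for x
  proof -
    have "(U has_derivative U) (at x within S)"
      using U bounded_linear_imp_has_derivative by blast
    from has_derivative_compose[OF this der[OF that, folded U_def]]
    have "((\<lambda>x. V (U x)) has_derivative (\<lambda>v. A (U x) * U v + B (U x) * cnj (U v))) (at x within S)" .
    from this show ?thesis
      unfolding f_def f'_def T_def[symmetric] U_def[symmetric] by (rule bounded_linear.has_derivative[OF T])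
  qed
  moreover have "det (matrix (f' x)) = (norm (A (U x)))\<^sup>2 - (norm (B (U x)))\<^sup>2" for x
  proof -
    have "U (axis 1 1) = 1" "U (axis 2 1) = \<i>"
      by (auto simp: U_def axis_def complex_eq_iff)
    then show ?thesis
      by (simp add: det_2 matrix_def f'_def T_def cmod_power2) (simp add: algebra_simps power2_eq_square)
  qed
  ultimately have "f ` S \<in> lmeasurable \<and> measure lebesgue (f ` S) = I"
    using has_measure_differentiable_image[OF S _ inj, of f' I] int by (simp add: U_def)
  then show "f ` S \<in> lmeasurable" "measure lebesgue (f ` S) = I"
    by auto
qed

section \<open>The length-area estimate\<close>

text \<open>\<open>Re (A - B)\<close> is the rate at which \<open>Im V\<close> grows along a
  vertical line. The bound 2x - 1 \<le> x^2 replaces Cauchy-Schwarz: it is linear in x, so it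
  integrates exactly, and it is sharp at x = 1, the mean growth rate over a period.\<close>

lemma length_le_area_density:
  fixes A B :: complex
  assumes "0 \<le> \<kappa>" "\<kappa> \<le> 1" "norm B \<le> \<kappa> * norm A"
  shows "(1 - \<kappa>) / (1 + \<kappa>) * (2 * Re (A - B) - 1) \<le> (norm A)\<^sup>2 - (norm B)\<^sup>2"
proof -
  define \<alpha> \<beta> where "\<alpha> = norm A" and "\<beta> = norm B"
  have "(Re (A - B))\<^sup>2 \<le> (norm (A - B))\<^sup>2"
    by (simp add: cmod_power2)
  also have "norm (A - B) \<le> \<alpha> + \<beta>"
    unfolding \<alpha>_def \<beta>_def by (rule norm_triangle_ineq4)
  then have "(norm (A - B))\<^sup>2 \<le> (\<alpha> + \<beta>)\<^sup>2"
    by (rule power_mono) simp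
  finally have "(Re (A - B))\<^sup>2 \<le> (\<alpha> + \<beta>)\<^sup>2" .
  moreover have "2 * Re (A - B) - 1 \<le> (Re (A - B))\<^sup>2"
    using zero_le_power2[of "Re (A - B) - 1"] by (simp add: power2_eq_square algebra_simps)
  ultimately have "(1 - \<kappa>) * (2 * Re (A - B) - 1) \<le> (1 - \<kappa>) * (\<alpha> + \<beta>)\<^sup>2"
    using assms by (intro mult_left_mono) auto
  also have "(1 - \<kappa>) * (\<alpha> + \<beta>) \<le> (1 + \<kappa>) * (\<alpha> - \<beta>)"
    using assms by (simp add: algebra_simps \<alpha>_def \<beta>_def)
  then have "(1 - \<kappa>) * (\<alpha> + \<beta>)\<^sup>2 \<le> (1 + \<kappa>) * (\<alpha> - \<beta>) * (\<alpha> + \<beta>)"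
    unfolding power2_eq_square mult.assoc[symmetric]
    by (intro mult_right_mono) (auto simp: \<alpha>_def \<beta>_def)
  also have "\<dots> = (1 + \<kappa>) * (\<alpha>\<^sup>2 - \<beta>\<^sup>2)"
    by (simp add: power2_eq_square algebra_simps)
  finally show ?thesis
    using assms by (simp add: \<alpha>_def \<beta>_def field_simps)
qed

text \<open>The area \<open>IJ\<close> of the image is squeezed between 2\<pi> times the integral of
  \<open>c\<close>, by integrating the pointwise estimate over vertical segments, and 2\<pi>M, by
  packing. Integration uses the closed rectangle \<open>R\<close>; injectivity is asked only on the
  open \<open>R'\<close>, because the horizontal edges of \<open>R\<close> have the same image
  modulo 2\<pi>\<i>.\<close>

lemma strip_length_area:
  fixes V A B :: "complex \<Rightarrow> complex" and \<kappa> :: "real \<Rightarrow> real" and a b M :: real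
  defines "R \<equiv> {z. a \<le> Re z \<and> Re z \<le> b \<and> 0 \<le> Im z \<and> Im z \<le> 2 * pi}"
    and "R' \<equiv> {z. a < Re z \<and> Re z < b \<and> 0 < Im z \<and> Im z < 2 * pi}"
  assumes "a < b"
    and der: "\<And>z. z \<in> R \<Longrightarrow> (V has_derivative (\<lambda>v. A z * v + B z * cnj v)) (at z)"
    and cont: "continuous_on R A" "continuous_on R B" "continuous_on {a..b} \<kappa>"
    and \<kappa>: "\<And>x. x \<in> {a..b} \<Longrightarrow> 0 \<le> \<kappa> x \<and> \<kappa> x \<le> 1"
    and dil: "\<And>z. z \<in> R \<Longrightarrow> norm (B z) \<le> \<kappa> (Re z) * norm (A z)"
    and period: "\<And>x. x \<in> {a..b} \<Longrightarrow> V (Complex x (2 * pi)) = V (Complex x 0) + 2 * pi * \<i>"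
    and inj: "\<And>z w. z \<in> R' \<Longrightarrow> w \<in> R' \<Longrightarrow> exp (V z) = exp (V w) \<Longrightarrow> z = w"
    and noninv: "\<And>z w. z \<in> R' \<Longrightarrow> w \<in> R' \<Longrightarrow> exp (V z) * exp (V w) \<noteq> 1"
    and strip: "\<And>z. z \<in> R \<Longrightarrow> \<bar>Re (V z)\<bar> \<le> M"
  shows "integral {a..b} (\<lambda>x. (1 - \<kappa> x) / (1 + \<kappa> x)) \<le> M"
proof -
  define c where "c x = (1 - \<kappa> x) / (1 + \<kappa> x)" for x
  define J where "J z = (norm (A z))\<^sup>2 - (norm (B z))\<^sup>2" for z
  define L where "L z = c (Re z) * (2 * Re (A z - B z) - 1)" for z
  define U where "U x = Complex (x$1) (x$2)" for x :: "real^2"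
  define f where "f x = (vector [Re (V (U x)), Im (V (U x))] :: real^2)" for x
  define Q where "Q = box (vector [a, 0] :: real^2) (vector [b, 2 * pi])"
  have Q: "x \<in> Q \<longleftrightarrow> U x \<in> R'" for x
    by (auto simp: Q_def U_def R'_def mem_box_cart forall_2)
  have cQ: "x \<in> cbox (vector [a, 0]) (vector [b, 2 * pi]) \<longleftrightarrow> U x \<in> R" for x :: "real^2"
    by (auto simp: U_def R_def mem_box_cart forall_2)
  have "R' \<subseteq> R"
    by (auto simp: R_def R'_def)
  have Uinj: "x = y" if "U x = U y" for x y
    using that by (auto simp: U_def vec_eq_iff forall_2)
  have cont_c: "continuous_on {a..b} c"
    unfolding c_def using cont(3) \<kappa> by (intro continuous_intros) fastforce+
  have "continuous_on R (\<lambda>z. c (Re z))"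
    by (rule continuous_on_compose2[OF cont_c]) (auto simp: R_def intro!: continuous_intros)
  then have contL: "continuous_on R L" and contJ: "continuous_on R J"
    unfolding L_def J_def by (intro continuous_intros cont; simp)+
  define IJ where "IJ = integral {a..b} (\<lambda>s. integral {0..2*pi} (\<lambda>t. J (Complex s t)))"
  define IL where "IL = integral {a..b} (\<lambda>s. integral {0..2*pi} (\<lambda>t. L (Complex s t)))"
  have LJ: "L z \<le> J z" if "z \<in> R" for z
    unfolding L_def J_def c_def
    by (rule length_le_area_density) (use \<kappa>[of "Re z"] dil[OF that] that in \<open>auto simp: R_def\<close>)
  have hJ: "((\<lambda>x. J (U x)) has_integral IJ) (cbox (vector [a, 0]) (vector [b, 2 * pi]))"
    unfolding U_def IJ_def by (rule has_integral_vec2) (use contJ in \<open>simp add: R_def\<close>)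
  have hL: "((\<lambda>x. L (U x)) has_integral IL) (cbox (vector [a, 0]) (vector [b, 2 * pi]))"
    unfolding U_def IL_def by (rule has_integral_vec2) (use contL in \<open>simp add: R_def\<close>)
  have "IL = integral {a..b} (\<lambda>x. c x * (2 * pi))"
    unfolding IL_def
  proof (rule integral_cong)
    fix s assume s: "s \<in> {a..b}"
    \<comment> \<open>By \<open>period\<close> this primitive increases by 2 * 2\<pi> - 2\<pi> =
      2\<pi> along the segment.\<close>
    have "((\<lambda>t. 2 * Im (V (Complex s t)) - t) has_vector_derivative
        2 * Re (A (Complex s t) - B (Complex s t)) - 1) (at t within {0..2*pi})"
      if t: "t \<in> {0..2*pi}" for t
    proof -
      have "Complex s t \<in> R"
        using s t by (simp add: R_def)
      note d = der[OF this]
      have "((\<lambda>t. Complex s t) has_derivative (\<lambda>h. Complex 0 h)) (at t within {0..2*pi})"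
        unfolding Complex_eq by (auto intro!: derivative_eq_intros)
      from has_derivative_compose[OF this d]
      have "((\<lambda>t. Im (V (Complex s t))) has_derivative
          (\<lambda>h. Im (A (Complex s t) * Complex 0 h + B (Complex s t) * cnj (Complex 0 h)))) (at t within {0..2*pi})"
        by (rule has_derivative_Im)
      then have "((\<lambda>t. 2 * Im (V (Complex s t)) - t) has_derivative
          (\<lambda>h. 2 * Im (A (Complex s t) * Complex 0 h + B (Complex s t) * cnj (Complex 0 h)) - h)) (at t within {0..2*pi})"
        by (intro has_derivative_diff has_derivative_mult_right has_derivative_ident)
      then show ?thesis
        unfolding has_vector_derivative_def by (rule has_derivative_eq_rhs) (auto simp: algebra_simps)
    qed
    then have "((\<lambda>t. 2 * Re (A (Complex s t) - B (Complex s t)) - 1) has_integral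
        (2 * Im (V (Complex s (2*pi))) - 2 * pi) - (2 * Im (V (Complex s 0)) - 0)) {0..2*pi}"
      by (intro fundamental_theorem_of_calculus) auto
    then have "((\<lambda>t. 2 * Re (A (Complex s t) - B (Complex s t)) - 1) has_integral 2 * pi) {0..2*pi}"
      by (simp add: period[OF s])
    then have "((\<lambda>t. L (Complex s t)) has_integral c s * (2 * pi)) {0..2*pi}"
      unfolding L_def complex.sel by (rule has_integral_mult_right)
    then show "integral {0..2*pi} (\<lambda>t. L (Complex s t)) = c s * (2 * pi)"
      by (rule integral_unique)
  qed
  also have "\<dots> = 2 * pi * integral {a..b} c"
    by simp
  finally have ILc: "IL = 2 * pi * integral {a..b} c" .
  have "IL \<le> IJ"
    using has_integral_le[OF hL hJ] LJ cQ by blast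

  \<comment> \<open>The area formula involves the absolute value of the Jacobian, the estimate above
    its signed value.\<close>
  have J0: "0 \<le> J z" if "z \<in> R" for z
  proof -
    have "norm (B z) \<le> norm (A z)"
      using dil[OF that] \<kappa>[of "Re z"] that mult_right_mono[of "\<kappa> (Re z)" 1 "norm (A z)"]
      by (auto simp: R_def)
    then show ?thesis
      by (simp add: J_def power_mono)
  qed
  have finj: "inj_on f Q"
  proof (rule inj_onI)
    fix x y assume xy: "x \<in> Q" "y \<in> Q" "f x = f y"
    then have "V (U x) = V (U y)"
      by (simp add: f_def vec_eq_iff forall_2 complex_eq_iff)
    with xy show "x = y"
      using inj[of "U x" "U y"] by (intro Uinj) (simp add: Q)
  qed
  have hJQ: "((\<lambda>x. \<bar>J (U x)\<bar>) has_integral IJ) Q"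
    unfolding Q_def has_integral_open_interval
    by (rule has_integral_eq[OF _ hJ]) (use J0 cQ in auto)
  have QM: "Q \<in> sets lebesgue"
    by (simp add: Q_def)
  have meas: "f ` Q \<in> lmeasurable" "measure lebesgue (f ` Q) = IJ"
    using has_integral_area_vec2[of Q V A B IJ] QM finj hJQ der \<open>R' \<subseteq> R\<close> Q
    by (auto simp: f_def[abs_def] J_def U_def)
  define f2 where "f2 x = (vector [Re (- V (U x)), Im (- V (U x))] :: real^2)" for x
  have f2: "f2 x = - f x" for x
    by (simp add: f_def f2_def vec_eq_iff forall_2)
  have "((\<lambda>z. - V z) has_derivative (\<lambda>v. - A z * v + - B z * cnj v)) (at z)" if "z \<in> R" for z
    using has_derivative_minus[OF der[OF that]] by simp
  moreover have "inj_on f2 Q"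
    using finj by (simp add: inj_on_def f2)
  ultimately have meas2: "f2 ` Q \<in> lmeasurable" "measure lebesgue (f2 ` Q) = IJ"
    using has_integral_area_vec2[of Q "\<lambda>z. - V z" "\<lambda>z. - A z" "\<lambda>z. - B z" IJ] QM hJQ \<open>R' \<subseteq> R\<close> Q
    by (auto simp: f2_def[abs_def] J_def U_def)
  \<comment> \<open>The images of the strip under \<open>V\<close> and \<open>-V\<close> are disjoint modulo \<open>2\<pi>\<i>\<close>, so together they occupy at
    most the area \<open>4\<pi>M\<close> of the cylinder \<open>\<bar>Re\<bar> \<le> M\<close>. This symmetry takes the place of the Koebe
    one-quarter theorem.\<close>
  define S where "S = f ` Q \<union> f2 ` Q"
  \<comment> \<open>\<open>E\<close> identifies exactly the points that differ by a vertical
    multiple of 2\<pi>, which turns \<open>inj\<close> and \<open>noninv\<close> into statements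
    about the cylinder.\<close>
  define E where "E x = exp (U x)" for x
  have UU: "U (f x) = V (U x)" "U (f2 x) = - V (U x)" for x
    by (auto simp: U_def f_def f2_def complex_eq_iff)
  have noEq: "E (f x) \<noteq> E (f2 y)" if "x \<in> Q" "y \<in> Q" for x y
    using noninv[of "U x" "U y"] that Q by (auto simp: E_def UU exp_minus field_simps)
  have "measure lebesgue S \<le> 2 * M * (2 * pi)"
  proof (rule measure_le_of_inj_mod_period)
    show "S \<in> lmeasurable"
      using meas meas2 by (auto simp: S_def)
    have "R = cbox (Complex a 0) (Complex b (2 * pi))"
      by (auto simp: R_def in_cbox_complex_iff)
    moreover have "continuous_on R V"
      using der has_derivative_continuous continuous_at_imp_continuous_on by blast
    ultimately have "bounded (V ` R)"
      by (metis compact_cbox compact_continuous_image compact_imp_bounded)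
    then obtain C where C: "\<And>z. z \<in> R \<Longrightarrow> norm (V z) \<le> C"
      by (auto simp: bounded_iff)
    have "norm (f x) \<le> 2 * C" "norm (f2 x) \<le> 2 * C" if "x \<in> Q" for x
    proof -
      have "norm (f x) \<le> \<bar>Re (V (U x))\<bar> + \<bar>Im (V (U x))\<bar>"
        using norm_le_l1_cart[of "f x"] by (simp add: f_def sum_2)
      also have "\<dots> \<le> 2 * C"
        using C[of "U x"] abs_Re_le_cmod[of "V (U x)"] abs_Im_le_cmod[of "V (U x)"] that Q \<open>R' \<subseteq> R\<close>
        by fastforce
      finally show "norm (f x) \<le> 2 * C" "norm (f2 x) \<le> 2 * C"
        by (auto simp: f2)
    qed
    then show "bounded S"
      by (auto simp: S_def bounded_iff)
    have "Complex a 0 \<in> R"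
      using \<open>a < b\<close> by (simp add: R_def)
    from strip[OF this] show "0 \<le> M"
      by simp
    show "\<bar>x$1\<bar> \<le> M" if "x \<in> S" for x
      using that strip \<open>R' \<subseteq> R\<close> Q by (auto simp: S_def f_def f2_def)
  next
    fix x y :: "real^2" and n :: int
    assume xy: "x \<in> S" "y \<in> S" "x$1 = y$1" "x$2 = y$2 + of_int n * (2 * pi)"
    then have "U x = U y + of_int (2 * n) * pi * \<i>"
      by (simp add: U_def complex_eq_iff)
    then have "E x = E y"
      unfolding E_def exp_eq by blast
    have E_inj: "u = v" if "u \<in> Q" "v \<in> Q" "E (f u) = E (f v) \<or> E (f2 u) = E (f2 v)" for u v
      using inj[of "U u" "U v"] that by (intro Uinj) (auto simp: Q E_def UU exp_minus)
    obtain u v where uv: "u \<in> Q" "v \<in> Q" "x = f u \<or> x = f2 u" "y = f v \<or> y = f2 v"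
      using xy(1,2) unfolding S_def by blast
    have "x = y"
      using uv(3,4) \<open>E x = E y\<close> noEq[OF uv(1,2)] noEq[OF uv(2,1)] E_inj[OF uv(1,2)]
      by (elim disjE) simp_all
    with xy show "n = 0"
      by simp
  qed auto
  moreover have "measure lebesgue S = 2 * IJ"
  proof -
    have "f ` Q \<inter> f2 ` Q = {}"
      using noEq by fastforce
    then show ?thesis
      using meas meas2 by (simp add: S_def measure_Un3)
  qed
  ultimately have "IJ \<le> 2 * pi * M"
    by (simp add: mult_ac)
  then have "2 * pi * integral {a..b} c \<le> 2 * pi * M"
    using ILc \<open>IL \<le> IJ\<close> by linarith
  then show ?thesis
    by (simp add: c_def[abs_def])
qed

section \<open>Omitted values of injective harmonic functions\<close>

text \<open>The function \<open>z * exp (p z)\<close> is \<open>q = (1 - s) / (1 + s)\<close> with \<open>s = sqrt (1 - F / w)\<close>, that is, the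
  solution of \<open>F = 4 w q / (1 + q)\<^sup>2\<close> with \<open>q 0 = 0\<close>.\<close>

lemma koebe_coordinate:
  fixes F :: "complex \<Rightarrow> complex"
  assumes "0 < r" and cont: "continuous_on (ball 0 r) F" and inj: "inj_on F (ball 0 r)" and F0: "F 0 = 0"
    and omit: "w \<notin> F ` ball 0 r"
    and quot: "((\<lambda>z. F z / z) \<longlongrightarrow> 1) (at 0)"
  obtains s p where
    "continuous_on (ball 0 r) s" "\<And>z. z \<in> ball 0 r \<Longrightarrow> s z \<noteq> 0"
    "continuous_on (ball 0 r) p" "norm (exp (p 0)) = 1 / (4 * norm w)"
    "inj_on (\<lambda>z. z * exp (p z)) (ball 0 r)"
    "\<And>z z'. z \<in> ball 0 r \<Longrightarrow> z' \<in> ball 0 r \<Longrightarrow> (z * exp (p z)) * (z' * exp (p z')) \<noteq> 1"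
    "\<And>z D. z \<in> ball 0 r - {0} \<Longrightarrow> (F has_derivative D) (at z) \<Longrightarrow>
       (p has_derivative (\<lambda>v. D v / (F z * s z) - v / z)) (at z)"
proof -
  have "w \<noteq> 0"
    using omit F0 \<open>0 < r\<close> by (metis centre_in_ball image_eqI)
  have "1 - F z / w \<noteq> 0" if "z \<in> ball 0 r" for z
    using omit that \<open>w \<noteq> 0\<close> by auto
  moreover have "continuous_on (ball 0 r) (\<lambda>z. 1 - F z / w)"
    using \<open>w \<noteq> 0\<close> by (intro continuous_intros cont) auto
  ultimately obtain L where L: "continuous_on (ball 0 r) L" "\<And>z. z \<in> ball 0 r \<Longrightarrow> 1 - F z / w = exp (L z)"
    using continuous_logarithm_on_ball[of 0 r "\<lambda>z. 1 - F z / w"] by blast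
  have L0: "exp (L 0) = 1"
    using L(2)[of 0] F0 \<open>0 < r\<close> by simp
  \<comment> \<open>\<open>L 0\<close> may be any multiple of 2\<pi>\<i>; subtracting it selects the
    square root with \<open>s 0 = 1\<close>.\<close>
  define s where "s z = exp ((L z - L 0) / 2)" for z
  have s_cont: "continuous_on (ball 0 r) s"
    unfolding s_def by (intro continuous_intros L(1)) auto
  have s_nz: "s z \<noteq> 0" and s0: "s 0 = 1" for z
    by (auto simp: s_def)
  have "x / 2 + x / 2 = x" for x :: complex
    by (simp add: complex_eq_iff)
  then have "(s z)\<^sup>2 = exp (L z - L 0)" for z
    by (simp only: s_def power2_eq_square mult_exp_exp)
  then have "(s z)\<^sup>2 = exp (L z)" for z
    by (simp add: exp_diff L0)
  then have s2: "F z = w * (1 - (s z)\<^sup>2)" if "z \<in> ball 0 r" for z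
    using L(2)[OF that] \<open>w \<noteq> 0\<close> by (simp add: field_simps)
  have s_inj: "z = z'" if "z \<in> ball 0 r" "z' \<in> ball 0 r" "(s z)\<^sup>2 = (s z')\<^sup>2" for z z'
    using that s2 inj by (metis inj_onD)
  \<comment> \<open>The value -1 has the same square as \<open>s 0\<close>, so it could occur only
    at 0, where \<open>s\<close> is 1.\<close>
  have s_m1: "1 + s z \<noteq> 0" if "z \<in> ball 0 r" for z
  proof
    assume "1 + s z = 0"
    then have "s z = -1"
      by (simp add: add_eq_0_iff)
    then have "z = 0"
      using s_inj[of z 0] s0 that \<open>0 < r\<close> by simp
    with s0 \<open>s z = -1\<close> show False
      by simp
  qed
  \<comment> \<open>The continuous extension of \<open>F z / z\<close> strips the zero of
    \<open>q\<close> at the origin, leaving the zero-free factor \<open>n\<close> with a continuous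
    logarithm \<open>p\<close>. Its value \<open>n 0 = 1 / (4 * w)\<close> gives the normalisation
    of \<open>p 0\<close>.\<close>
  define N where "N z = (if z = 0 then 1 else F z / z)" for z
  have N: "z * N z = F z" for z
    by (simp add: N_def F0)
  have "continuous (at z) N" if "z \<in> ball 0 r" for z
  proof (cases "z = 0")
    case True
    have "(N \<longlongrightarrow> 1) (at 0)"
      using quot by (rule Lim_transform_eventually) (auto simp: N_def eventually_at_filter)
    then show ?thesis
      using True by (simp add: isCont_def N_def)
  next
    case False
    have "isCont F z"
      using cont that continuous_on_eq_continuous_at open_ball by blast
    then have "isCont (\<lambda>z. F z / z) z"
      using False by (intro continuous_intros) auto
    moreover have "\<forall>\<^sub>F x in nhds z. F x / x = N x"
      using t1_space_nhds[OF False] by eventually_elim (simp add: N_def)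
    ultimately show ?thesis
      using isCont_cong[of "\<lambda>z. F z / z" N z] by simp
  qed
  then have N_cont: "continuous_on (ball 0 r) N"
    by (simp add: continuous_at_imp_continuous_on)
  define q where "q z = (1 - s z) / (1 + s z)" for z
  define n where "n z = N z / (w * (1 + s z)\<^sup>2)" for z
  have qn: "z * n z = q z" if "z \<in> ball 0 r" for z
  proof -
    have "z * n z = F z / (w * (1 + s z)\<^sup>2)"
      by (simp add: n_def N[symmetric])
    also have "F z = w * ((1 - s z) * (1 + s z))"
      using s2[OF that] by (simp add: power2_eq_square algebra_simps)
    also have "\<dots> / (w * (1 + s z)\<^sup>2) = ((1 - s z) * (1 + s z)) / ((1 + s z) * (1 + s z))"
      using \<open>w \<noteq> 0\<close> unfolding power2_eq_square by simp
    finally show ?thesis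
      using s_m1[OF that] by (simp add: q_def)
  qed
  have "continuous_on (ball 0 r) n"
    unfolding n_def using s_m1 \<open>w \<noteq> 0\<close> by (intro continuous_intros N_cont s_cont) auto
  moreover have n_nz: "n z \<noteq> 0" if "z \<in> ball 0 r" for z
  proof -
    have "F z \<noteq> 0" if "z \<noteq> 0"
      using inj F0 \<open>z \<in> ball 0 r\<close> that \<open>0 < r\<close> by (metis centre_in_ball inj_onD)
    then show ?thesis
      using that s_m1 \<open>w \<noteq> 0\<close> by (auto simp: n_def N_def)
  qed
  ultimately obtain p where p: "continuous_on (ball 0 r) p" "\<And>z. z \<in> ball 0 r \<Longrightarrow> n z = exp (p z)"
    using continuous_logarithm_on_ball by blast
  have q: "z * exp (p z) = q z" if "z \<in> ball 0 r" for z
    using p(2) qn that by simp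
  show ?thesis
  proof (rule that)
    show "norm (exp (p 0)) = 1 / (4 * norm w)"
      using p(2)[of 0, symmetric] \<open>0 < r\<close>
      by (simp add: n_def N_def s0 norm_divide norm_mult del: norm_exp_eq_Re)
    show "inj_on (\<lambda>z. z * exp (p z)) (ball 0 r)"
    proof (rule inj_onI)
      fix z z' assume z: "z \<in> ball 0 r" "z' \<in> ball 0 r" and "z * exp (p z) = z' * exp (p z')"
      then have "(1 - s z) * (1 + s z') = (1 - s z') * (1 + s z)"
        using s_m1 by (simp add: q q_def field_simps)
      then have "s z = s z'"
        by (simp add: algebra_simps)
      with z s_inj show "z = z'"
        by simp
    qed
    \<comment> \<open>Replacing \<open>q\<close> by its inverse replaces \<open>s\<close> by
      \<open>-s\<close>. A product 1 thus gives equal squares, hence \<open>z = z'\<close> and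
      \<open>s z = 0\<close>, which is impossible.\<close>
    show "(z * exp (p z)) * (z' * exp (p z')) \<noteq> 1" if z: "z \<in> ball 0 r" "z' \<in> ball 0 r" for z z'
    proof
      assume "(z * exp (p z)) * (z' * exp (p z')) = 1"
      then have "q z * q z' = 1"
        by (simp only: q z)
      then have "(1 - s z) * (1 - s z') = (1 + s z) * (1 + s z')"
        using z[THEN s_m1] by (simp add: q_def field_simps)
      then have "2 * (s z + s z') = 0"
        by algebra
      then have "s z + s z' = 0"
        by (metis mult_eq_0_iff zero_neq_numeral)
      then have eq: "s z = - s z'"
        by (simp add: eq_neg_iff_add_eq_0)
      then have "z = z'"
        using s_inj z by simp
      with eq s_nz show False
        by simp
    qed
  next
    fix z D assume z: "z \<in> ball 0 r - {0}" and F': "(F has_derivative D) (at z)"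
    have zb: "z \<in> ball 0 r" and "z \<noteq> 0"
      using z by auto
    have "F z \<noteq> 0"
      using inj F0 zb \<open>z \<noteq> 0\<close> \<open>0 < r\<close> by (metis centre_in_ball inj_onD)
    have "((\<lambda>z. 1 - F z / w) has_derivative (\<lambda>v. - (D v / w))) (at z)"
      using has_derivative_diff[OF has_derivative_const bounded_linear.has_derivative[OF bounded_linear_divide F']]
      by simp
    then have "(L has_derivative (\<lambda>v. - (D v / w) / (1 - F z / w))) (at z)"
      by (rule has_derivative_continuous_log[OF open_ball zb L(1), rotated]) (simp add: L(2))
    then have L': "(L has_derivative (\<lambda>v. - (D v / w) / (s z)\<^sup>2)) (at z)"
      using s2[OF zb] \<open>w \<noteq> 0\<close> by simp
    have "((\<lambda>z. (L z - L 0) / 2) has_derivative (\<lambda>v. (- (D v / w) / (s z)\<^sup>2) / 2)) (at z)"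
      using bounded_linear.has_derivative[OF bounded_linear_divide has_derivative_diff[OF L' has_derivative_const]]
      by simp
    moreover have "(exp has_derivative (*) (s z)) (at ((L z - L 0) / 2))"
      using DERIV_exp[of "(L z - L 0) / 2"] by (simp only: has_field_derivative_def s_def)
    ultimately have "(s has_derivative (\<lambda>v. s z * ((- (D v / w) / (s z)\<^sup>2) / 2))) (at z)"
      unfolding s_def[abs_def] by (rule has_derivative_compose)
    then have s': "(s has_derivative (\<lambda>v. - D v / (2 * w * s z))) (at z)"
      by (rule has_derivative_eq_rhs) (use s_nz[of z] in \<open>simp add: fun_eq_iff power2_eq_square\<close>)
    define S where "S = s z"
    have S: "S \<noteq> 0" "1 + S \<noteq> 0" "F z = w * ((1 - S) * (1 + S))"
      using s_nz[of z] s_m1[OF zb] s2[OF zb] by (simp_all add: S_def power2_eq_square algebra_simps)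
    then have "1 - S \<noteq> 0"
      using \<open>F z \<noteq> 0\<close> by auto
    \<comment> \<open>Since \<open>q = F / (w * (1 + s)^2)\<close>, this says that the logarithmic
      derivative of \<open>q\<close> is \<open>D v / (F z * s z)\<close>; passing to
      \<open>q z / z\<close> subtracts \<open>v / z\<close>.\<close>
    have "(q has_derivative (\<lambda>v. D v / (w * S * (1 + S)\<^sup>2))) (at z)"
      unfolding q_def
      by (rule has_derivative_eq_rhs, (rule derivative_intros s' s_m1[OF zb])+)
        (use S \<open>w \<noteq> 0\<close> in \<open>simp add: fun_eq_iff divide_simps power2_eq_square flip: S_def; algebra\<close>)
    then have "((\<lambda>z. q z / z) has_derivative
        (\<lambda>v. (q z / z) * (D v / (F z * s z) - v / z))) (at z)"
      by (rule has_derivative_eq_rhs[OF has_derivative_divide'[OF _ has_derivative_ident \<open>z \<noteq> 0\<close>]])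
        (use S \<open>1 - S \<noteq> 0\<close> \<open>w \<noteq> 0\<close> \<open>z \<noteq> 0\<close> in \<open>simp add: fun_eq_iff divide_simps power2_eq_square q_def flip: S_def; algebra\<close>)
    then have "(p has_derivative (\<lambda>v. (q z / z) * (D v / (F z * s z) - v / z) / (q z / z))) (at z)"
    proof (rule has_derivative_continuous_log[OF _ z, rotated 3])
      show "continuous_on (ball 0 r - {0}) p"
        using p(1) by (rule continuous_on_subset) auto
      show "exp (p z) = q z / z" if "z \<in> ball 0 r - {0}" for z
        using that q[of z] by (auto simp: field_simps)
    qed (simp add: open_delete)
    moreover have "q z \<noteq> 0"
      using q[OF zb] \<open>z \<noteq> 0\<close> by (metis exp_not_eq_zero mult_eq_0_iff)
    ultimately show "(p has_derivative (\<lambda>v. D v / (F z * s z) - v / z)) (at z)"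
      using \<open>z \<noteq> 0\<close> by simp
  qed (use s_cont s_nz p in auto)
qed

text \<open>The integrand has the primitive \<open>G\<close>; the logarithm at the lower endpoint
  enters with a positive sign and is dropped.\<close>

lemma inverse_dilatation_integral_ge:
  fixes k m a b :: real
  assumes "a \<le> b" "0 \<le> k" "0 < m"
  shows "b - a - 2 / m * ln (1 + k * exp (m * b)) \<le> integral {a..b} (\<lambda>x. (1 - k * exp (m * x)) / (1 + k * exp (m * x)))"
proof -
  define G where "G x = x - 2 / m * ln (1 + k * exp (m * x))" for x
  have pos: "0 < 1 + k * exp (m * x)" for x
    using \<open>0 \<le> k\<close> by (simp add: add_pos_nonneg)
  have "(G has_vector_derivative (1 - k * exp (m * x)) / (1 + k * exp (m * x))) (at x within {a..b})" for x
  proof -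
    have "(G has_real_derivative 1 - 2 / m * (k * (exp (m * x) * m) / (1 + k * exp (m * x)))) (at x within {a..b})"
      unfolding G_def using pos[of x] by (auto intro!: derivative_eq_intros)
    moreover have "1 - 2 / m * (k * (exp (m * x) * m) / (1 + k * exp (m * x))) = (1 - k * exp (m * x)) / (1 + k * exp (m * x))"
      using pos[of x] \<open>0 < m\<close> by (simp add: divide_simps)
    ultimately show ?thesis
      by (simp add: has_real_derivative_iff_has_vector_derivative)
  qed
  then have "((\<lambda>x. (1 - k * exp (m * x)) / (1 + k * exp (m * x))) has_integral G b - G a) {a..b}"
    by (intro fundamental_theorem_of_calculus assms)
  moreover have "0 \<le> 2 / m * ln (1 + k * exp (m * a))"
    using assms by simp
  ultimately show ?thesis
    by (simp add: integral_unique G_def)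
qed

text \<open>In \<open>strip_length_area\<close>, applied to \<open>V z = z + p (exp z)\<close>, the
  term \<open>- ln \<epsilon>\<close> appears on both sides and cancels. What remains of the choice
  of \<epsilon> is the error \<eta>, from the continuity of \<open>p\<close> at 0.\<close>

lemma omitted_value_log_bound:
  fixes F h g :: "complex \<Rightarrow> complex" and r k m \<beta> \<eta> :: real
  assumes "0 < r" "0 \<le> k" "0 < m" "k * r powr m \<le> 1"
    and h: "h holomorphic_on ball 0 r" and g: "g holomorphic_on ball 0 r"
    and F: "\<And>z. z \<in> ball 0 r \<Longrightarrow> F z = h z + cnj (g z)"
    and F0: "F 0 = 0" and h'0: "deriv h 0 = 1" and inj: "inj_on F (ball 0 r)"
    and dil: "\<And>z. z \<in> ball 0 r \<Longrightarrow> norm (deriv g z) \<le> k * norm z powr m * norm (deriv h z)"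
    and omit: "w \<notin> F ` ball 0 r"
    and \<beta>: "0 < \<beta>" "\<beta> < r" and "0 < \<eta>"
  shows "ln \<beta> - 2 / m * ln (1 + k * \<beta> powr m) \<le> ln (4 * norm w) + \<eta>"
proof -
  have "w \<noteq> 0"
    using omit F0 \<open>0 < r\<close> by (metis centre_in_ball image_eqI)
  define D where "D z v = deriv h z * v + cnj (deriv g z * v)" for z v
  have F': "(F has_derivative D z) (at z)" if "z \<in> ball 0 r" for z
  proof -
    have "(h has_derivative (*) (deriv h z)) (at z)" "(g has_derivative (*) (deriv g z)) (at z)"
      using holomorphic_derivI[OF h open_ball that] holomorphic_derivI[OF g open_ball that]
      by (auto simp: has_field_derivative_def)
    then have "((\<lambda>z. h z + cnj (g z)) has_derivative D z) (at z)"
      unfolding D_def[abs_def] by (intro has_derivative_add has_derivative_cnj)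
    then show ?thesis
      by (rule has_derivative_transform_within_open[OF _ open_ball that]) (simp add: F)
  qed
  then have contF: "continuous_on (ball 0 r) F"
    using has_derivative_continuous continuous_at_imp_continuous_on by blast
  \<comment> \<open>Here \<open>0 powr m = 0\<close> turns the dilatation bound into g'(0) = 0, so
    \<open>F\<close> is tangent to the identity at 0.\<close>
  have "norm (deriv g 0) \<le> 0"
    using dil[of 0] \<open>0 < r\<close> by simp
  then have "(F has_derivative (\<lambda>v. v)) (at 0)"
    using F'[of 0] \<open>0 < r\<close> h'0 by (simp add: D_def[abs_def])
  then have "((\<lambda>z. norm (F z - z) / norm z) \<longlongrightarrow> 0) (at 0)"
    by (simp add: has_derivative_at F0)
  then have "((\<lambda>z. norm (F z / z - 1)) \<longlongrightarrow> 0) (at 0)"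
    by (rule Lim_transform_eventually)
      (auto simp: eventually_at_filter norm_divide[symmetric] diff_divide_distrib)
  then have quot: "((\<lambda>z. F z / z) \<longlongrightarrow> 1) (at 0)"
    using LIM_zero_cancel tendsto_norm_zero_iff by blast
  obtain s p where s: "continuous_on (ball 0 r) s" "\<And>z. z \<in> ball 0 r \<Longrightarrow> s z \<noteq> 0"
    and p: "continuous_on (ball 0 r) p" "norm (exp (p 0)) = 1 / (4 * norm w)"
    and q_inj: "inj_on (\<lambda>z. z * exp (p z)) (ball 0 r)"
    and q_inv: "\<And>z z'. z \<in> ball 0 r \<Longrightarrow> z' \<in> ball 0 r \<Longrightarrow> (z * exp (p z)) * (z' * exp (p z')) \<noteq> 1"
    and p': "\<And>z D. z \<in> ball 0 r - {0} \<Longrightarrow> (F has_derivative D) (at z) \<Longrightarrow>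
       (p has_derivative (\<lambda>v. D v / (F z * s z) - v / z)) (at z)"
    by (rule koebe_coordinate[OF \<open>0 < r\<close> contF inj F0 omit quot]) (rule that; blast)
  have "exp (Re (p 0)) = exp (- ln (4 * norm w))"
    using p(2) \<open>w \<noteq> 0\<close> by (simp add: exp_minus field_simps)
  then have p0: "Re (p 0) = - ln (4 * norm w)"
    by simp
  have "isCont p 0"
    using p(1) \<open>0 < r\<close> by (simp add: continuous_on_eq_continuous_at)
  then obtain d where d: "d > 0" "\<And>z. dist z 0 < d \<Longrightarrow> dist (p z) (p 0) < \<eta>"
    using \<open>0 < \<eta>\<close> unfolding continuous_at_eps_delta by blast
  define \<epsilon> where "\<epsilon> = min (d / 2) (\<beta> / 2)"
  have \<epsilon>: "0 < \<epsilon>" "\<epsilon> < d" "\<epsilon> < \<beta>"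
    using d(1) \<beta>(1) by (auto simp: \<epsilon>_def min_def)
  \<comment> \<open>On the circle of radius \<epsilon>, |q| equals \<epsilon> exp(Re p) and Re p
    exceeds Re p(0) - \<eta>, so |q| is at least exp(-M).\<close>
  define M where "M = - ln \<epsilon> + ln (4 * norm w) + \<eta>"
  define q where "q z = z * exp (p z)" for z
  have far: "exp (- M) \<le> norm (q z)" if "z \<in> sphere 0 \<epsilon>" for z
  proof -
    have "\<bar>Re (p z - p 0)\<bar> < \<eta>"
      using d(2)[of z] that \<epsilon> abs_Re_le_cmod[of "p z - p 0"] by (simp add: dist_norm)
    then have "- M \<le> ln \<epsilon> + Re (p z)"
      using p0 by (simp add: M_def)
    then have "exp (- M) \<le> exp (ln \<epsilon> + Re (p z))"
      by simp
    then show ?thesis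
      using that \<epsilon> by (simp add: q_def norm_mult exp_add)
  qed
  have sub: "cball 0 \<epsilon> \<subseteq> ball (0::complex) r"
    using \<epsilon>(3) \<beta>(2) by (simp add: subset_eq)
  have contq: "continuous_on (ball 0 r) q"
    unfolding q_def[abs_def] by (rule continuous_on_mult[OF continuous_on_id continuous_on_exp[OF p(1)]])
  have q_inj': "inj_on q (ball 0 r)"
    using q_inj by (simp add: q_def[abs_def])
  have "ball (q 0) (exp (- M)) \<subseteq> q ` ball 0 \<epsilon>"
  proof (rule ball_subset_inj_image)
    show "continuous_on (cball 0 \<epsilon>) q" "inj_on q (cball 0 \<epsilon>)"
      using contq q_inj' sub by (auto intro: continuous_on_subset inj_on_subset)
    show "exp (- M) \<le> dist (q 0) (q z)" if "z \<in> sphere 0 \<epsilon>" for z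
      using far[OF that] by (simp add: q_def dist_norm)
  qed (rule \<epsilon>)
  then have cover: "v \<in> q ` ball 0 \<epsilon>" if "norm v < exp (- M)" for v
    using that by (auto simp: q_def)
  \<comment> \<open>Values of modulus below exp(-M) are already taken inside the \<epsilon>-disk.
    Injectivity therefore excludes them outside it, and \<open>q_inv\<close> excludes their
    inverses.\<close>
  have q_low: "exp (- M) \<le> norm (q z)" and q_high: "norm (q z) \<le> exp M"
    if "z \<in> ball 0 r" "\<epsilon> \<le> norm z" for z
  proof -
    have no: "\<not> norm (q z) < exp (- M)"
    proof
      assume "norm (q z) < exp (- M)"
      then obtain z' where z': "z' \<in> ball 0 \<epsilon>" "q z = q z'"
        using cover by blast
      then have "z = z'"
        using inj_onD[OF q_inj', of z z'] that(1) \<epsilon>(3) \<beta>(2) by auto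
      with z' that show False
        by simp
    qed
    then show "exp (- M) \<le> norm (q z)"
      by simp
    show "norm (q z) \<le> exp M"
    proof (rule ccontr)
      assume "\<not> norm (q z) \<le> exp M"
      then have "norm (inverse (q z)) < exp (- M)"
        by (simp add: norm_inverse exp_minus less_imp_inverse_less)
      then obtain z' where "z' \<in> ball 0 \<epsilon>" "inverse (q z) = q z'"
        using cover by blast
      moreover have "q z \<noteq> 0"
        using no by auto
      ultimately have "z' \<in> ball 0 r" "q z * q z' = 1"
        using \<epsilon>(3) \<beta>(2) by (auto simp: divide_simps mult.commute)
      with q_inv[OF that(1)] show False
        by (simp add: q_def)
    qed
  qed
  define V where "V z = z + p (exp z)" for z
  define N where "N z = F (exp z) * s (exp z)" for z
  \<comment> \<open>\<open>A\<close> and \<open>B\<close> are the coefficients of \<open>v\<close>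
    and \<open>cnj v\<close> in the derivative of \<open>V\<close>: the summand \<open>z\<close> of
    \<open>V\<close> cancels the term \<open>- v / z\<close> in the derivative of \<open>p\<close>.
    The quotient of their moduli is that of g' and h' at \<open>exp z\<close>.\<close>
  define A where "A z = exp z * deriv h (exp z) / N z" for z
  define B where "B z = cnj (exp z * deriv g (exp z)) / N z" for z
  define R where "R = {z. ln \<epsilon> \<le> Re z \<and> Re z \<le> ln \<beta> \<and> 0 \<le> Im z \<and> Im z \<le> 2 * pi}"
  have exp_in: "exp z \<in> ball 0 r - {0} \<and> \<epsilon> \<le> norm (exp z)" if "ln \<epsilon> \<le> Re z" "Re z \<le> ln \<beta>" for z
  proof -
    have "exp (ln \<epsilon>) \<le> exp (Re z)" "exp (Re z) \<le> exp (ln \<beta>)"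
      using that by auto
    then show ?thesis
      using \<epsilon> \<beta> by simp
  qed
  have expV: "exp (V z) = q (exp z)" for z
    by (simp add: V_def q_def exp_add)
  have F_nz: "F z \<noteq> 0" if "z \<in> ball 0 r - {0}" for z
    using inj F0 that \<open>0 < r\<close> by (metis Diff_iff centre_in_ball inj_onD singletonI)
  have N_nz: "N z \<noteq> 0" if "z \<in> R" for z
    using that exp_in[of z] F_nz s(2) by (auto simp: N_def R_def)
  have cont_exp: "continuous_on R (\<lambda>z. f (exp z))" if "continuous_on (ball 0 r) f" for f :: "complex \<Rightarrow> complex"
    by (rule continuous_on_compose2[OF that]) (use exp_in in \<open>auto simp: R_def intro!: continuous_intros\<close>)
  have cont_deriv: "continuous_on (ball 0 r) (deriv h)" "continuous_on (ball 0 r) (deriv g)"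
    using h g by (auto intro!: holomorphic_on_imp_continuous_on holomorphic_deriv)
  have contN: "continuous_on R N"
    unfolding N_def by (intro continuous_intros cont_exp contF s)
  have "integral {ln \<epsilon>..ln \<beta>} (\<lambda>x. (1 - k * exp (m * x)) / (1 + k * exp (m * x))) \<le> M"
  proof (rule strip_length_area[where V = V and A = A and B = B and a = "ln \<epsilon>" and b = "ln \<beta>", folded R_def])
    show "ln \<epsilon> < ln \<beta>"
      using \<epsilon> \<beta> by simp
    show "(V has_derivative (\<lambda>v. A z * v + B z * cnj v)) (at z)" if "z \<in> R" for z
    proof -
      have z: "exp z \<in> ball 0 r - {0}"
        using that exp_in by (simp add: R_def)
      have "(exp has_derivative (\<lambda>v. exp z * v)) (at z)"
        using DERIV_exp[of z] by (simp add: has_field_derivative_def)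
      from has_derivative_compose[OF this p'[OF z F']] z
      have "(V has_derivative (\<lambda>v. v + (D (exp z) (exp z * v) / N z - exp z * v / exp z))) (at z)"
        unfolding V_def[abs_def] N_def by (intro has_derivative_add has_derivative_ident) auto
      then show ?thesis
        by (rule has_derivative_eq_rhs) (auto simp: D_def A_def B_def fun_eq_iff add_divide_distrib mult_ac)
    qed
    show "continuous_on R A" "continuous_on R B"
      unfolding A_def B_def using N_nz by (intro continuous_intros cont_exp contN cont_deriv; simp)+
    show "continuous_on {ln \<epsilon>..ln \<beta>} (\<lambda>x. k * exp (m * x))"
      by (intro continuous_intros)
    have powr: "exp (m * x) = exp x powr m" for x :: real
      by (simp add: powr_def)
    show "0 \<le> k * exp (m * x) \<and> k * exp (m * x) \<le> 1" if "x \<in> {ln \<epsilon>..ln \<beta>}" for x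
    proof -
      have "exp x powr m \<le> r powr m"
        using exp_in[of "of_real x"] that \<open>0 < m\<close> by (intro powr_mono2) auto
      then have "k * exp (m * x) \<le> k * r powr m"
        unfolding powr using \<open>0 \<le> k\<close> by (rule mult_left_mono)
      then show ?thesis
        using assms(2,4) by simp
    qed
    show "norm (B z) \<le> k * exp (m * Re z) * norm (A z)" if "z \<in> R" for z
    proof -
      have "norm (deriv g (exp z)) \<le> k * exp (m * Re z) * norm (deriv h (exp z))"
        using dil[of "exp z"] exp_in[of z] that by (simp add: R_def powr)
      then have "exp (Re z) * norm (deriv g (exp z)) / norm (N z) \<le>
          exp (Re z) * (k * exp (m * Re z) * norm (deriv h (exp z))) / norm (N z)"
        by (intro divide_right_mono mult_left_mono) auto
      then show ?thesis
        by (simp add: A_def B_def norm_divide norm_mult mult_ac)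
    qed
    show "V (Complex x (2 * pi)) = V (Complex x 0) + 2 * pi * \<i>" if "x \<in> {ln \<epsilon>..ln \<beta>}" for x
    proof -
      have eq: "Complex x (2 * pi) = Complex x 0 + 2 * pi * \<i>"
        by (simp add: complex_eq_iff)
      have "exp (Complex x (2 * pi)) = exp (Complex x 0)"
        unfolding eq exp_add by simp
      then show ?thesis
        unfolding V_def by (simp add: eq)
    qed
    show "z = z'" if "z \<in> {z. ln \<epsilon> < Re z \<and> Re z < ln \<beta> \<and> 0 < Im z \<and> Im z < 2 * pi}"
      "z' \<in> {z. ln \<epsilon> < Re z \<and> Re z < ln \<beta> \<and> 0 < Im z \<and> Im z < 2 * pi}" "exp (V z) = exp (V z')" for z z'
    proof (rule exp_complex_eqI)
      show "exp z = exp z'"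
        using that exp_in[of z] exp_in[of z'] inj_onD[OF q_inj, of "exp z" "exp z'"]
        by (auto simp: expV q_def)
      show "\<bar>Im z - Im z'\<bar> < 2 * pi"
        using that by auto
    qed
    show "exp (V z) * exp (V z') \<noteq> 1" if "z \<in> {z. ln \<epsilon> < Re z \<and> Re z < ln \<beta> \<and> 0 < Im z \<and> Im z < 2 * pi}"
      "z' \<in> {z. ln \<epsilon> < Re z \<and> Re z < ln \<beta> \<and> 0 < Im z \<and> Im z < 2 * pi}" for z z'
      using q_inv[of "exp z" "exp z'"] that exp_in[of z] exp_in[of z'] by (simp add: expV q_def)
    show "\<bar>Re (V z)\<bar> \<le> M" if "z \<in> R" for z
    proof -
      have "norm (q (exp z)) = exp (Re (V z))"
        by (simp flip: expV)
      then have "exp (- M) \<le> exp (Re (V z))" "exp (Re (V z)) \<le> exp M"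
        using q_low[of "exp z"] q_high[of "exp z"] exp_in[of z] that by (auto simp: R_def)
      then show ?thesis
        by simp
    qed
  qed
  then have "ln \<beta> - ln \<epsilon> - 2 / m * ln (1 + k * exp (m * ln \<beta>)) \<le> M"
    using inverse_dilatation_integral_ge[of "ln \<epsilon>" "ln \<beta>" k m] \<epsilon> \<beta> assms(2,3) by simp
  then show ?thesis
    using \<beta> by (simp add: M_def powr_def)
qed

text \<open>The logarithmic bound holds for every \<eta> > 0 and every \<beta> < r; first \<eta>
  tends to 0, then \<beta> tends to r from the left.\<close>

lemma omitted_value_bound:
  fixes F h g :: "complex \<Rightarrow> complex" and r k m :: real
  assumes "0 < r" "0 \<le> k" "0 < m" "k * r powr m \<le> 1"
    and h: "h holomorphic_on ball 0 r" and g: "g holomorphic_on ball 0 r"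
    and F: "\<And>z. z \<in> ball 0 r \<Longrightarrow> F z = h z + cnj (g z)"
    and F0: "F 0 = 0" and h'0: "deriv h 0 = 1" and inj: "inj_on F (ball 0 r)"
    and dil: "\<And>z. z \<in> ball 0 r \<Longrightarrow> norm (deriv g z) \<le> k * norm z powr m * norm (deriv h z)"
    and omit: "w \<notin> F ` ball 0 r"
  shows "r / (4 * (1 + k * r powr m) powr (2 / m)) \<le> norm w"
proof -
  have "w \<noteq> 0"
    using omit F0 \<open>0 < r\<close> by (metis centre_in_ball image_eqI)
  have pos: "0 < 1 + k * \<beta> powr m" for \<beta>
    using \<open>0 \<le> k\<close> by (simp add: add_pos_nonneg)
  have bound: "\<beta> / (4 * (1 + k * \<beta> powr m) powr (2 / m)) \<le> norm w" if "0 < \<beta>" "\<beta> < r" for \<beta>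
  proof -
    have "ln \<beta> - 2 / m * ln (1 + k * \<beta> powr m) \<le> ln (4 * norm w)"
      using omitted_value_log_bound[OF assms that] by (rule field_le_epsilon)
    then have "exp (ln \<beta> - 2 / m * ln (1 + k * \<beta> powr m)) \<le> exp (ln (4 * norm w))"
      by simp
    then have "\<beta> / (1 + k * \<beta> powr m) powr (2 / m) \<le> 4 * norm w"
      using that \<open>w \<noteq> 0\<close> pos[of \<beta>] by (simp add: exp_diff powr_def[of "1 + k * \<beta> powr m"])
    then show ?thesis
      by (simp add: field_simps)
  qed
  have "((\<lambda>\<beta>. \<beta> / (4 * (1 + k * \<beta> powr m) powr (2 / m))) \<longlongrightarrow>
      r / (4 * (1 + k * r powr m) powr (2 / m))) (at_left r)"
    using \<open>0 < r\<close> pos[of r] by (intro tendsto_intros) auto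
  moreover have "\<forall>\<^sub>F \<beta> in at_left r. \<beta> / (4 * (1 + k * \<beta> powr m) powr (2 / m)) \<le> norm w"
    using eventually_at_left_real[OF \<open>0 < r\<close>] by eventually_elim (use bound in auto)
  ultimately show ?thesis
    by (rule tendsto_upperbound) simp
qed

text \<open>The convention \<open>x / 0 = 0\<close> makes the hypothesis on the dilatation void at zeros of \<open>h'\<close>; there the
  inequality is recovered by continuity, since these zeros are isolated.\<close>

lemma norm_deriv_le_of_dilatation_le:
  assumes h: "h holomorphic_on S" and g: "g holomorphic_on S" and S: "open S" "connected S"
    and "a \<in> S" "deriv h a \<noteq> 0" and \<kappa>: "continuous_on S \<kappa>"
    and dil: "\<And>z. z \<in> S \<Longrightarrow> norm (dilatation h g z) \<le> \<kappa> z"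
    and z: "z \<in> S"
  shows "norm (deriv g z) \<le> \<kappa> z * norm (deriv h z)"
proof (cases "deriv h z = 0")
  case False
  then show ?thesis
    using dil[OF z] by (simp add: dilatation_def norm_divide pos_divide_le_eq)
next
  case True
  have h': "deriv h holomorphic_on S" and g': "deriv g holomorphic_on S"
    using h g S by (auto intro: holomorphic_deriv)
  obtain e where e: "0 < e" "ball z e \<subseteq> S" "\<And>w. w \<in> ball z e - {z} \<Longrightarrow> deriv h w \<noteq> 0"
    using isolated_zeros[OF h' S z True \<open>a \<in> S\<close> \<open>deriv h a \<noteq> 0\<close>] by metis
  have cont: "isCont (deriv h) z" "isCont (deriv g) z" "isCont \<kappa> z"
    using h' g' \<kappa> S z by (auto simp: continuous_on_eq_continuous_at dest!: holomorphic_on_imp_continuous_on)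
  have "\<forall>\<^sub>F w in at z. norm (deriv g w) \<le> \<kappa> w * norm (deriv h w)"
  proof -
    have "\<forall>\<^sub>F w in at z. w \<in> ball z e - {z}"
      using \<open>0 < e\<close> by (auto simp: eventually_at dist_commute)
    then show ?thesis
    proof eventually_elim
      case (elim w)
      with e(2) e(3)[of w] dil[of w] show ?case
        by (auto simp: dilatation_def norm_divide pos_divide_le_eq)
    qed
  qed
  then show ?thesis
    using tendsto_le[of "at z" "\<lambda>w. \<kappa> w * norm (deriv h w)" "\<kappa> z * norm (deriv h z)"
      "\<lambda>w. norm (deriv g w)" "norm (deriv g z)"] cont
    by (simp add: isCont_def tendsto_intros)
qed

section \<open>Growth estimate and covered disk\<close>

theorem theorem1:
  fixes k m :: real and F :: "complex \<Rightarrow> complex"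
  assumes "0 \<le> k" "k \<le> 1" "1 \<le> m"
    and "F \<in> S_H0_km k m"
  shows "(\<forall>z\<in>\<D>. norm (F z) \<ge> norm z / (4 * (1 + k * norm z powr m) powr (2 / m))) \<and>
         {w. norm w < 1 / (4 * (1 + k) powr (2 / m))} \<subseteq> F ` \<D>"
proof -
  obtain h g where hg: "harmonic_decomp F h g"
    and w: "\<And>z. z \<in> \<D> \<Longrightarrow> norm (dilatation h g z) \<le> k * norm z powr m"
    using assms(4) by (auto simp: S_H0_km_def)
  obtain h0 g0 where hg0: "harmonic_decomp F h0 g0" "deriv h0 0 = 1" and inj: "inj_on F \<D>"
    using assms(4) by (auto simp: S_H0_km_def S_H0_def)
  have hol: "h holomorphic_on \<D>" "g holomorphic_on \<D>" and F: "\<And>z. z \<in> \<D> \<Longrightarrow> F z = h z + cnj (g z)"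
    and "h 0 = 0" "g 0 = 0"
    using hg by (auto simp: harmonic_decomp_def)
  then have F0: "F 0 = 0"
    by simp
  \<comment> \<open>The normalisation and the dilatation bound come with separately chosen
    decompositions of \<open>F\<close>; uniqueness identifies them on the disk.\<close>
  have "deriv h 0 = deriv h0 0"
    by (rule complex_derivative_transform_within_open[OF _ _ open_ball])
      (use hg hg0 harmonic_decomp_unique in \<open>auto simp: harmonic_decomp_def\<close>)
  then have h'0: "deriv h 0 = 1"
    using hg0 by simp
  have dil: "norm (deriv g z) \<le> k * norm z powr m * norm (deriv h z)" if "z \<in> \<D>" for z
  proof (rule norm_deriv_le_of_dilatation_le[OF hol, of 0])
    show "continuous_on \<D> (\<lambda>z. k * norm z powr m)"
      using \<open>1 \<le> m\<close> by (intro continuous_intros continuous_on_powr') auto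
  qed (use w that h'0 in auto)
  have bound: "r / (4 * (1 + k * r powr m) powr (2 / m)) \<le> norm w"
    if "0 < r" "r \<le> 1" "w \<notin> F ` ball 0 r" for r w
  proof (rule omitted_value_bound)
    have sub: "ball 0 r \<subseteq> \<D>"
      using that by auto
    show "h holomorphic_on ball 0 r" "g holomorphic_on ball 0 r" "inj_on F (ball 0 r)"
      using hol inj sub by (auto intro: holomorphic_on_subset inj_on_subset)
    have "r powr m \<le> 1 powr m"
      using that \<open>1 \<le> m\<close> by (intro powr_mono2) auto
    then have "k * r powr m \<le> 1 * 1"
      using assms by (intro mult_mono) auto
    then show "k * r powr m \<le> 1"
      by simp
    show "F z = h z + cnj (g z)" "norm (deriv g z) \<le> k * norm z powr m * norm (deriv h z)"
      if "z \<in> ball 0 r" for z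
      using that sub F dil by auto
  qed (use assms that F0 h'0 in auto)
  show ?thesis
  proof (intro conjI ballI subsetI)
    fix z assume z: "z \<in> \<D>"
    show "norm z / (4 * (1 + k * norm z powr m) powr (2 / m)) \<le> norm (F z)"
    proof (cases "z = 0")
      case False
      \<comment> \<open>Univalence makes \<open>F z\<close> an omitted value on the smaller disk, so
        the growth estimate is the omitted-value bound with r = |z|; the covering claim is the case
        r = 1.\<close>
      have "F z \<notin> F ` ball 0 (norm z)"
        using inj z by (force dest: inj_onD)
      then show ?thesis
        using bound[of "norm z"] False z by simp
    qed simp
  next
    fix w :: complex assume "w \<in> {w. norm w < 1 / (4 * (1 + k) powr (2 / m))}"
    then show "w \<in> F ` \<D>"
      using bound[of 1 w] by force
  qed
qed

end
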